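(* Let $E\subseteq\partial T$ be closed. If $\operatorname{Cap}^T(E)>0$, then $$\lim_{n\to\infty}\operatorname{Cap}^T_n(E)=+\infty .$$
   Context: $T$ is the infinite rooted dyadic tree with root $o$: every vertex $x$ has exactly two children $x_+,x_-$, and every vertex other than $o$ has exactly one parent. $d(x)$ is the number of edges in the geodesic from $o$ to $x$, so $d(o)=0$; $P(x)=[o,x]$ is the set of vertices on this geodesic, endpoints included. The boundary $\partial T$ is the set of half-infinite geodesics starting at $o$; for $\zeta\in\partial T$, $P(\zeta)$ is the set of vertices of the geodesic $\zeta$. For distinct $\xi,\zeta\in\partial T$, $\xi\wedge\zeta$ is the vertex of largest level $d$ in $P(\xi)\cap P(\zeta)$, and $\partial T$ carries the metric $\rho(\xi,\zeta)=2^{-d(\xi\wedge\zeta)}$ (with $\rho(\xi,\xi)=0$); "closed" refers to this metric. For $\varphi:T\to[0,\infty)$ put $I\varphi(\zeta)=\sum_{x\in P(\zeta)}\varphi(x)$ for $\zeta\in T\cup\partial T$, and $\|\varphi\|_{\ell^2}^2=\sum_{x\in T}\varphi(x)^2$. For closed $E\subseteq\partial T$, $$\operatorname{Cap}^T(E)=\inf\{\|\varphi\|_{\ell^2}^2:\ \varphi\ge0,\ I\varphi\ge1\text{ on }E\},$$ and for an integer $n\ge1$, $$\operatorname{Cap}^T_n(E)=\inf\{\|\varphi\|_{\ell^2}^2:\ \varphi\ge0,\ I\varphi\ge1\text{ on }E,\ I\varphi(x)=0\ \text{for all }x\in T\text{ with }d(x)=n-1\};$$ also $\operatorname{Cap}^T_0(E)=\operatorname{Cap}^T(E)$.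 *)

theory Defs
  imports "HOL-Analysis.Analysis" "HOL-Library.Sublist"
begin

text \<open>
  Vertices of the rooted dyadic tree are finite binary words: the root is the empty word, and the
  children of \<open>x\<close> are \<open>x @ [True]\<close> and \<open>x @ [False]\<close>. The level of a vertex is its length.
\<close>

type_synonym vertex = "bool list"

abbreviation level :: "vertex \<Rightarrow> nat" where
  "level x \<equiv> length x"

definition is_child :: "vertex \<Rightarrow> vertex \<Rightarrow> bool" where
  "is_child y x \<longleftrightarrow> (\<exists>b. y = x @ [b])"

text \<open>The vertices on the geodesic from the root to \<open>x\<close> are exactly the prefixes of \<open>x\<close>.\<close>

definition vertex_path :: "vertex \<Rightarrow> vertex set" where
  "vertex_path x = {y. prefix y x}"

text \<open>
  A half-infinite geodesic from the root is the sequence of its vertices; since it never turns back,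
  each vertex is a child of the preceding one.
\<close>

definition tree_boundary :: "(nat \<Rightarrow> vertex) set" where
  "tree_boundary = {\<zeta>. \<zeta> 0 = [] \<and> (\<forall>n. is_child (\<zeta> (Suc n)) (\<zeta> n))}"

definition boundary_path :: "(nat \<Rightarrow> vertex) \<Rightarrow> vertex set" where
  "boundary_path \<zeta> = range \<zeta>"

definition meet :: "(nat \<Rightarrow> vertex) \<Rightarrow> (nat \<Rightarrow> vertex) \<Rightarrow> vertex" where
  "meet \<xi> \<zeta> = (ARG_MAX level x. x \<in> boundary_path \<xi> \<inter> boundary_path \<zeta>)"

definition rho :: "(nat \<Rightarrow> vertex) \<Rightarrow> (nat \<Rightarrow> vertex) \<Rightarrow> real" where
  "rho \<xi> \<zeta> = (if \<xi> = \<zeta> then 0 else 1 / 2 ^ level (meet \<xi> \<zeta>))"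

text \<open>
  Sums of nonnegative terms are taken in \<^typ>\<open>ennreal\<close>, so that a divergent sum has
  the value \<open>\<infinity>\<close>.
\<close>

definition potential :: "(vertex \<Rightarrow> real) \<Rightarrow> (nat \<Rightarrow> vertex) \<Rightarrow> ennreal" where
  "potential \<phi> \<zeta> = (\<Sum>\<^sub>\<infinity>x\<in>boundary_path \<zeta>. ennreal (\<phi> x))"

definition vertex_potential :: "(vertex \<Rightarrow> real) \<Rightarrow> vertex \<Rightarrow> ennreal" where
  "vertex_potential \<phi> x = (\<Sum>\<^sub>\<infinity>y\<in>vertex_path x. ennreal (\<phi> y))"

definition energy :: "(vertex \<Rightarrow> real) \<Rightarrow> ennreal" where
  "energy \<phi> = (\<Sum>\<^sub>\<infinity>x. ennreal ((\<phi> x)\<^sup>2))"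

definition Cap :: "(nat \<Rightarrow> vertex) set \<Rightarrow> ennreal" where
  "Cap E = (INF \<phi> \<in> {\<phi>. (\<forall>x. 0 \<le> \<phi> x) \<and> (\<forall>\<zeta>\<in>E. 1 \<le> potential \<phi> \<zeta>)}. energy \<phi>)"

definition Cap_level :: "nat \<Rightarrow> (nat \<Rightarrow> vertex) set \<Rightarrow> ennreal" where
  "Cap_level n E =
    (if n = 0 then Cap E
     else (INF \<phi> \<in> {\<phi>. (\<forall>x. 0 \<le> \<phi> x) \<and> (\<forall>\<zeta>\<in>E. 1 \<le> potential \<phi> \<zeta>) \<and>
                       (\<forall>x. level x = n - 1 \<longrightarrow> vertex_potential \<phi> x = 0)}. energy \<phi>))"

lemma level_boundary:
  assumes "\<zeta> \<in> tree_boundary"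
  shows "level (\<zeta> n) = n"
proof (induction n)
  case 0
  show ?case using assms by (simp add: tree_boundary_def)
next
  case (Suc n)
  obtain b where "\<zeta> (Suc n) = \<zeta> n @ [b]"
    using assms unfolding tree_boundary_def is_child_def by blast
  then show ?case using Suc by simp
qed

lemma boundary_agree_mono:
  assumes "\<xi> \<in> tree_boundary" "\<zeta> \<in> tree_boundary" "\<xi> n = \<zeta> n" "k \<le> n"
  shows "\<xi> k = \<zeta> k"
  using assms(4,3)
proof (induction rule: inc_induct)
  case base
  then show ?case .
next
  case (step m)
  obtain b c where "\<xi> (Suc m) = \<xi> m @ [b]" "\<zeta> (Suc m) = \<zeta> m @ [c]"
    using assms(1,2) unfolding tree_boundary_def is_child_def by blast
  then show ?case using step by simp
qed

lemma common_vertex_iff: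
  assumes "\<xi> \<in> tree_boundary" "\<zeta> \<in> tree_boundary"
  shows "x \<in> boundary_path \<xi> \<inter> boundary_path \<zeta> \<longleftrightarrow>
         \<xi> (level x) = \<zeta> (level x) \<and> x = \<xi> (level x)"
proof
  assume "x \<in> boundary_path \<xi> \<inter> boundary_path \<zeta>"
  then obtain m n where "x = \<xi> m" "x = \<zeta> n" unfolding boundary_path_def by blast
  then show "\<xi> (level x) = \<zeta> (level x) \<and> x = \<xi> (level x)"
    using level_boundary[OF assms(1), of m] level_boundary[OF assms(2), of n] by simp
next
  assume "\<xi> (level x) = \<zeta> (level x) \<and> x = \<xi> (level x)"
  then show "x \<in> boundary_path \<xi> \<inter> boundary_path \<zeta>"
    unfolding boundary_path_def by (metis IntI rangeI)
qed

lemma agree_iff_level_meet: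
  assumes "\<xi> \<in> tree_boundary" "\<zeta> \<in> tree_boundary" "\<xi> \<noteq> \<zeta>"
  shows "\<xi> n = \<zeta> n \<longleftrightarrow> n \<le> level (meet \<xi> \<zeta>)"
proof -
  let ?P = "\<lambda>x. x \<in> boundary_path \<xi> \<inter> boundary_path \<zeta>"
  obtain N where N: "\<xi> N \<noteq> \<zeta> N" using assms(3) by blast
  have bound: "\<forall>y. ?P y \<longrightarrow> level y < N"
  proof (intro allI impI)
    fix y assume "?P y"
    then have "\<xi> (level y) = \<zeta> (level y)"
      using common_vertex_iff[OF assms(1,2)] by blast
    then show "level y < N"
      using boundary_agree_mono[OF assms(1,2)] N not_le by blast
  qed
  have "\<xi> 0 = [] \<and> \<zeta> 0 = []" using assms by (simp add: tree_boundary_def)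
  then have root: "?P []" using common_vertex_iff[OF assms(1,2), of "[]"] by simp
  have meet_P: "?P (meet \<xi> \<zeta>)"
    unfolding meet_def using arg_max_natI[of ?P, OF root bound] .
  show ?thesis
  proof
    assume eq: "\<xi> n = \<zeta> n"
    then have "?P (\<xi> n)"
      unfolding boundary_path_def by (metis IntI rangeI)
    from arg_max_nat_le[of ?P, OF this bound] show "n \<le> level (meet \<xi> \<zeta>)"
      by (simp add: meet_def level_boundary[OF assms(1)])
  next
    assume "n \<le> level (meet \<xi> \<zeta>)"
    then show "\<xi> n = \<zeta> n"
      using meet_P common_vertex_iff[OF assms(1,2)] boundary_agree_mono[OF assms(1,2)] by blast
  qed
qed

lemma Metric_space_boundary: "Metric_space tree_boundary rho"
proof
  fix \<xi> \<zeta>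
  show "0 \<le> rho \<xi> \<zeta>" by (simp add: rho_def)
  show "rho \<xi> \<zeta> = rho \<zeta> \<xi>" by (simp add: rho_def meet_def Int_commute)
  show "rho \<xi> \<zeta> = 0 \<longleftrightarrow> \<xi> = \<zeta>" by (simp add: rho_def)
next
  fix \<xi> \<zeta> \<eta>
  assume B: "\<xi> \<in> tree_boundary" "\<zeta> \<in> tree_boundary" "\<eta> \<in> tree_boundary"
  show "rho \<xi> \<eta> \<le> rho \<xi> \<zeta> + rho \<zeta> \<eta>"
  proof (cases "\<xi> = \<zeta> \<or> \<zeta> = \<eta> \<or> \<xi> = \<eta>")
    case True
    then show ?thesis by (auto simp: rho_def)
  next
    case False
    let ?m = "level (meet \<xi> \<zeta>)" and ?n = "level (meet \<zeta> \<eta>)"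
    have "\<xi> (min ?m ?n) = \<zeta> (min ?m ?n)" "\<zeta> (min ?m ?n) = \<eta> (min ?m ?n)"
      using agree_iff_level_meet[OF B(1,2)] agree_iff_level_meet[OF B(2,3)] False by auto
    then have le: "min ?m ?n \<le> level (meet \<xi> \<eta>)"
      using agree_iff_level_meet[OF B(1,3)] False by auto
    have "rho \<xi> \<eta> \<le> 1 / 2 ^ min ?m ?n"
      using False le by (simp add: rho_def frac_le)
    also have "\<dots> \<le> 1 / 2 ^ ?m + 1 / 2 ^ ?n"
      by (simp add: min_def)
    also have "\<dots> = rho \<xi> \<zeta> + rho \<zeta> \<eta>"
      using False by (simp add: rho_def)
    finally show ?thesis .
  qed
qed

end

theory Submission
  imports Defs
begin

text \<open>
  Since \<open>Cap_level n E\<close> is nondecreasing in \<open>n\<close>, it suffices to exclude a finite supremum \<open>L > 0\<close>.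
  Take \<open>\<phi>\<close> almost minimal at level \<open>n\<close>, then \<open>m\<close> so large that \<open>\<phi>\<close> has almost no energy
  beyond level \<open>m\<close>, and \<open>\<psi>\<close> almost minimal at level \<open>m\<close>. The two functions are almost orthogonal, so
  their mean, which is admissible at level \<open>n\<close>, has energy close to \<open>L / 2\<close>. Hence a finite
  supremum forces \<open>L \<le> c * L\<close> with \<open>c < 1\<close>, which contradicts \<open>Cap E > 0\<close>.
\<close>

lemma infsum_cmult_right_ennreal:
  fixes f :: "'a \<Rightarrow> ennreal"
  shows "(\<Sum>\<^sub>\<infinity>x\<in>A. c * f x) = c * (\<Sum>\<^sub>\<infinity>x\<in>A. f x)"
  by (simp add: nonneg_infsum_complete SUP_mult_left_ennreal sum_distrib_left)

text \<open>The total is the supremum of the finite partial sums, so finiteness puts one of them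
  within \<open>e\<close> of it. This yields the finite set that carries nearly all the energy of
  \<phi>.\<close>

lemma infsum_ennreal_tail:
  fixes f :: "'a \<Rightarrow> ennreal" and e :: real
  assumes "(\<Sum>\<^sub>\<infinity>x. f x) < \<infinity>" "0 < e"
  obtains F where "finite F" "(\<Sum>\<^sub>\<infinity>x\<in>-F. f x) < e"
proof -
  have "\<exists>F\<in>{F. finite F \<and> F \<subseteq> UNIV}. (\<Sum>\<^sub>\<infinity>x. f x) < sum f F + e"
  proof (rule SUP_approx_ennreal[where f = "sum f"])
    show "(\<Sum>\<^sub>\<infinity>x. f x) = (SUP F\<in>{F. finite F \<and> F \<subseteq> UNIV}. sum f F)"
      by (rule nonneg_infsum_complete) simp
  qed (use assms in auto)
  then obtain F where F: "finite F" "(\<Sum>\<^sub>\<infinity>x. f x) < sum f F + e" by auto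
  have split: "(\<Sum>\<^sub>\<infinity>x. f x) = sum f F + (\<Sum>\<^sub>\<infinity>x\<in>-F. f x)"
    using infsum_Un_disjoint[of f F "-F"] F(1) by (simp add: nonneg_summable_on_complete)
  with F(2) have "(\<Sum>\<^sub>\<infinity>x\<in>-F. f x) < e"
    by (metis add_left_mono leD leI)
  with F(1) show thesis by (rule that)
qed

text \<open>For nonnegative functions, zero potential on level \<open>n - 1\<close> amounts to
  vanishing on all levels below \<open>n\<close>. In this form \<open>n = 0\<close> imposes nothing,
  so the case split in \<open>Cap_level\<close> disappears.\<close>

definition admissible :: "nat \<Rightarrow> (nat \<Rightarrow> vertex) set \<Rightarrow> (vertex \<Rightarrow> real) set" where
  "admissible n E = {\<phi>. (\<forall>x. 0 \<le> \<phi> x) \<and> (\<forall>\<zeta>\<in>E. 1 \<le> potential \<phi> \<zeta>) \<and> (\<forall>x. level x < n \<longrightarrow> \<phi> x = 0)}"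

lemma vertex_potential_eq_0_iff:
  assumes "\<And>x. 0 \<le> \<phi> x"
  shows "vertex_potential \<phi> x = 0 \<longleftrightarrow> (\<forall>y. prefix y x \<longrightarrow> \<phi> y = 0)"
proof -
  have "vertex_path x = set (prefixes x)"
    by (auto simp: vertex_path_def)
  then have "vertex_potential \<phi> x = (\<Sum>y\<in>set (prefixes x). ennreal (\<phi> y))"
    by (simp add: vertex_potential_def)
  then show ?thesis
    using assms by (auto simp: ennreal_eq_0_iff order_antisym simp del: sum_ennreal)
qed

lemma vertex_potential_level_eq_0_iff:
  assumes "\<And>x. 0 \<le> \<phi> x"
  shows "(\<forall>x. level x = n \<longrightarrow> vertex_potential \<phi> x = 0) \<longleftrightarrow> (\<forall>x. level x \<le> n \<longrightarrow> \<phi> x = 0)"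
proof safe
  fix y :: vertex
  assume 0: "\<forall>x. level x = n \<longrightarrow> vertex_potential \<phi> x = 0" and "level y \<le> n"
  \<comment> \<open>Any descendant of \<open>y\<close> on level \<open>n\<close> will do, since its
    geodesic from the root passes through \<open>y\<close>.\<close>
  then have "level (y @ replicate (n - level y) True) = n" by simp
  with 0 have "vertex_potential \<phi> (y @ replicate (n - level y) True) = 0" by blast
  then show "\<phi> y = 0"
    using assms by (simp add: vertex_potential_eq_0_iff)
next
  fix x :: vertex
  assume "\<forall>y. level y \<le> level x \<longrightarrow> \<phi> y = 0"
  then show "vertex_potential \<phi> x = 0"
    using assms by (simp add: vertex_potential_eq_0_iff prefix_length_le)
qed

lemma Cap_level_eq: "Cap_level n E = (INF \<phi>\<in>admissible n E. energy \<phi>)"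
proof (cases n)
  case 0
  then show ?thesis by (simp add: Cap_level_def Cap_def admissible_def)
next
  case (Suc k)
  have "admissible n E = {\<phi>. (\<forall>x. 0 \<le> \<phi> x) \<and> (\<forall>\<zeta>\<in>E. 1 \<le> potential \<phi> \<zeta>) \<and>
      (\<forall>x. level x = n - 1 \<longrightarrow> vertex_potential \<phi> x = 0)}"
    unfolding admissible_def Suc
    by (intro Collect_cong conj_cong refl) (simp add: vertex_potential_level_eq_0_iff less_Suc_eq_le)
  then show ?thesis
    by (simp add: Cap_level_def Suc)
qed

text \<open>Raising \<open>n\<close> shrinks the class over which the infimum is taken.\<close>

lemma incseq_Cap_level: "incseq (\<lambda>n. Cap_level n E)"
  unfolding Cap_level_eq by (intro monoI INF_superset_mono) (auto simp: admissible_def)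

lemma potential_mean:
  assumes "\<And>x. 0 \<le> \<phi> x" "\<And>x. 0 \<le> \<psi> x"
  shows "potential (\<lambda>x. (\<phi> x + \<psi> x) / 2) \<zeta> = ennreal (1/2) * (potential \<phi> \<zeta> + potential \<psi> \<zeta>)"
proof -
  have "ennreal ((\<phi> x + \<psi> x) / 2) = ennreal (1/2) * (ennreal (\<phi> x) + ennreal (\<psi> x))" for x
    using assms by (simp del: ennreal_half flip: ennreal_plus ennreal_mult)
  then show ?thesis
    by (simp add: potential_def infsum_cmult_right_ennreal infsum_add nonneg_summable_on_complete)
qed

text \<open>The class at level \<open>n\<close> is convex and, as \<open>n \<le> m\<close>, contains
  the class at level \<open>m\<close>.\<close>

lemma admissible_mean:
  assumes "\<phi> \<in> admissible n E" "\<psi> \<in> admissible m E" "n \<le> m"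
  shows "(\<lambda>x. (\<phi> x + \<psi> x) / 2) \<in> admissible n E"
proof -
  have "1 \<le> ennreal (1/2) * (potential \<phi> \<zeta> + potential \<psi> \<zeta>)" if "\<zeta> \<in> E" for \<zeta>
  proof -
    have "(1::ennreal) = ennreal (1/2) * (1 + 1)"
      using ennreal_mult[of "1/2" 2, symmetric] by (simp del: ennreal_half)
    also have "\<dots> \<le> ennreal (1/2) * (potential \<phi> \<zeta> + potential \<psi> \<zeta>)"
      using assms that by (intro mult_left_mono add_mono) (auto simp: admissible_def)
    finally show ?thesis .
  qed
  then show ?thesis
    using assms by (auto simp: admissible_def potential_mean)
qed

text \<open>Expanding the square gives 1/4 of each energy plus half the product of \<phi> and
  \<psi>. The product vanishes on \<open>F\<close>, so its cost in \<phi> falls only on the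
  tail.\<close>

lemma energy_mean_le:
  assumes "\<And>x. x \<in> F \<Longrightarrow> \<psi> x = 0"
  shows "energy (\<lambda>x. (\<phi> x + \<psi> x) / 2) \<le>
    ennreal (1/4) * energy \<phi> + ennreal (3/8) * energy \<psi> +
    ennreal (1/2) * (\<Sum>\<^sub>\<infinity>x\<in>-F. ennreal ((\<phi> x)\<^sup>2))"
proof -
  let ?t = "\<lambda>x. if x \<in> F then 0 else ennreal ((\<phi> x)\<^sup>2)"
  have pointwise: "ennreal (((\<phi> x + \<psi> x) / 2)\<^sup>2) \<le>
      ennreal (1/4) * ennreal ((\<phi> x)\<^sup>2) + ennreal (3/8) * ennreal ((\<psi> x)\<^sup>2) + ennreal (1/2) * ?t x" for x
  proof (cases "x \<in> F")
    case True
    with assms show ?thesis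
      by (simp add: power_divide flip: ennreal_mult)
  next
    case False
    \<comment> \<open>This bounds half the product by half the square of \<phi> plus 1/8 of the
      square of \<psi>, whence 3/8 = 1/4 + 1/8.\<close>
    have "0 \<le> (2 * \<phi> x - \<psi> x)\<^sup>2" by simp
    then have "((\<phi> x + \<psi> x) / 2)\<^sup>2 \<le> 1/4 * (\<phi> x)\<^sup>2 + 3/8 * (\<psi> x)\<^sup>2 + 1/2 * (\<phi> x)\<^sup>2"
      by (simp add: power2_eq_square field_simps)
    then show ?thesis
      using False by (simp del: ennreal_half flip: ennreal_mult ennreal_plus)
  qed
  have tail: "(\<Sum>\<^sub>\<infinity>x. ?t x) = (\<Sum>\<^sub>\<infinity>x\<in>-F. ennreal ((\<phi> x)\<^sup>2))"
    by (rule infsum_cong_neutral) auto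
  have "energy (\<lambda>x. (\<phi> x + \<psi> x) / 2) \<le> (\<Sum>\<^sub>\<infinity>x. ennreal (1/4) * ennreal ((\<phi> x)\<^sup>2) +
      ennreal (3/8) * ennreal ((\<psi> x)\<^sup>2) + ennreal (1/2) * ?t x)"
    unfolding energy_def by (intro infsum_mono pointwise nonneg_summable_on_complete) simp_all
  also have "\<dots> = ennreal (1/4) * energy \<phi> + ennreal (3/8) * energy \<psi> + ennreal (1/2) * (\<Sum>\<^sub>\<infinity>x. ?t x)"
    by (simp only: infsum_add nonneg_summable_on_complete zero_le infsum_cmult_right_ennreal energy_def)
  finally show ?thesis unfolding tail .
qed

lemma Cap_level_contraction:
  fixes c :: real
  assumes "\<And>n. Cap_level n E < ennreal c"
  shows "Cap_level n E \<le> ennreal (3/4 * c)"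
proof -
  have c: "0 < c"
    using assms[of 0] by (metis ennreal_neg not_le not_less_zero)
  obtain \<phi> where \<phi>: "\<phi> \<in> admissible n E" "energy \<phi> < ennreal c"
    using assms[of n] by (auto simp: Cap_level_eq INF_less_iff)
  have "energy \<phi> < \<infinity>"
    using \<phi>(2) by (simp add: order_less_trans)
  \<comment> \<open>The threshold \<open>c / 4\<close> makes the final constant 1/4 + 3/8 + 1/8 =
    3/4.\<close>
  then obtain F where F: "finite F" "(\<Sum>\<^sub>\<infinity>x\<in>-F. ennreal ((\<phi> x)\<^sup>2)) < ennreal (c / 4)"
    unfolding energy_def using c by (elim infsum_ennreal_tail[where e = "c / 4"]) auto
  obtain k where k: "\<And>x. x \<in> F \<Longrightarrow> level x < k"
    using F(1) finite_nat_set_iff_bounded[of "level ` F"] by auto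
  \<comment> \<open>Level \<open>k\<close> forces \<psi> to vanish on \<open>F\<close>; the maximum
    with \<open>n\<close> keeps the mean admissible at level \<open>n\<close>.\<close>
  obtain \<psi> where \<psi>: "\<psi> \<in> admissible (max n k) E" "energy \<psi> < ennreal c"
    using assms[of "max n k"] by (auto simp: Cap_level_eq INF_less_iff)
  have \<psi>0: "\<psi> x = 0" if "x \<in> F" for x
    using k[OF that] \<psi>(1) by (simp add: admissible_def)
  have "Cap_level n E \<le> energy (\<lambda>x. (\<phi> x + \<psi> x) / 2)"
    unfolding Cap_level_eq by (intro INF_lower admissible_mean[OF \<phi>(1) \<psi>(1)]) simp
  also have "\<dots> \<le> ennreal (1/4) * energy \<phi> + ennreal (3/8) * energy \<psi> +
      ennreal (1/2) * (\<Sum>\<^sub>\<infinity>x\<in>-F. ennreal ((\<phi> x)\<^sup>2))"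
    using \<psi>0 by (rule energy_mean_le)
  also have "\<dots> \<le> ennreal (1/4) * ennreal c + ennreal (3/8) * ennreal c + ennreal (1/2) * ennreal (c / 4)"
    using \<phi>(2) \<psi>(2) F(2) by (intro add_mono mult_left_mono) auto
  also have "\<dots> = ennreal (3/4 * c)"
    using c by (simp del: ennreal_half flip: ennreal_mult ennreal_plus)
  finally show ?thesis .
qed

theorem theorem6:
  fixes E :: "(nat \<Rightarrow> vertex) set"
  assumes "closedin (Metric_space.mtopology tree_boundary rho) E"
    and "Cap E > 0"
  shows "(\<lambda>n. Cap_level n E) \<longlonglongrightarrow> \<infinity>"
proof -
  define L where "L = (SUP n. Cap_level n E)"
  have "L = \<infinity>"
  proof (rule ccontr)
    assume "L \<noteq> \<infinity>"
    then obtain l where l: "L = ennreal l" "0 \<le> l"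
      by (cases L) auto
    have le: "Cap_level n E \<le> L" for n
      unfolding L_def by (rule SUP_upper) simp
    \<comment> \<open>Level 0 is \<open>Cap E\<close> itself, so its positivity passes to the
      supremum.\<close>
    have "0 < L"
      using le[of 0] assms(2) by (simp add: Cap_level_def)
    with l have "0 < l" by simp
    \<comment> \<open>Any factor strictly between 1 and 4/3 works: above 1 for the strict bound,
      below 4/3 for a contraction. Here 3/4 * 7/6 = 7/8.\<close>
    then have "Cap_level n E < ennreal (7/6 * l)" for n
      using le[of n] l by (auto intro!: ennreal_lessI elim: order.strict_trans1)
    from Cap_level_contraction[OF this] have "L \<le> ennreal (3/4 * (7/6 * l))"
      unfolding L_def by (intro SUP_least)
    with \<open>0 < l\<close> l show False by simp
  qed
  then show ?thesis
    using LIMSEQ_SUP[OF incseq_Cap_level[of E]] by (simp only: flip: L_def)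
qed

end
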